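(* Let $A=\begin{bmatrix} M & C \\ D & F \end{bmatrix}$ be a square complex matrix whose rows and columns are indexed by a finite set $V$ partitioned as $V=S\cup\overline{S}$, with $S$ nonempty and the block $M$ indexed by $S\times S$. Let $\Sigma=\begin{bmatrix} I \\ 0 \end{bmatrix}$ be the matrix with rows indexed by $S\cup\overline{S}$ and columns indexed by $S$. Then $$\mathcal{R}(\lambda,S,A)=\lambda I-\left(\Sigma^T(\lambda I-A)^{-1}\Sigma\right)^{-1}.$$
   Context: For $A=\begin{bmatrix} M & C \\ D & F \end{bmatrix}$ with the $M$ block indexed by $S$, the isospectral reduction of $A$ to $S$ is $\mathcal{R}(\lambda,S,A)=M+C(\lambda I-F)^{-1}D$, an $|S|\times|S|$ matrix whose entries are rational functions in the variable $\lambda$. Identities are between matrices over the field $\mathbb{C}(\lambda)$ of rational functions. *)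

theory Defs
  imports
    "Jordan_Normal_Form.Gauss_Jordan_Elimination"
    "HOL-Computational_Algebra.Polynomial_Factorial"
begin

text \<open>
  A matrix whose rows and columns are indexed by a finite set \<open>V\<close> is a function
  \<open>A :: 'v \<Rightarrow> 'v \<Rightarrow> complex\<close>, of which only the values on \<open>V\<close> are used. Listing the row
  and column labels without repetition turns it, or a block of it, into an array.
\<close>

definition block :: "('v \<Rightarrow> 'v \<Rightarrow> 'a) \<Rightarrow> 'v list \<Rightarrow> 'v list \<Rightarrow> 'a mat" where
  "block A rs cs = mat (length rs) (length cs) (\<lambda>(i, j). A (rs ! i) (cs ! j))"

text \<open>
  The display \<open>A = [M C; D F]\<close>: the list \<open>ss\<close> enumerates \<open>S\<close> and \<open>ts\<close> enumerates its complement
  in \<open>V\<close>. If \<open>ts = []\<close>, the blocks other than \<open>M\<close> are empty.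
\<close>

definition block_form :: "('v \<Rightarrow> 'v \<Rightarrow> 'a) \<Rightarrow> 'v list \<Rightarrow> 'v list \<Rightarrow> 'a mat" where
  "block_form A ss ts =
     four_block_mat (block A ss ss) (block A ss ts)
                    (block A ts ss) (block A ts ts)"

text \<open>The field of rational functions over the complex numbers is \<open>complex poly fract\<close>.\<close>

definition lam :: "complex poly fract" where
  "lam = to_fract [:0, 1:]"

definition const_mat :: "complex mat \<Rightarrow> complex poly fract mat" where
  "const_mat B = map_mat (\<lambda>c. to_fract [:c:]) B"

definition lam_minus :: "complex mat \<Rightarrow> complex poly fract mat" where
  "lam_minus B = lam \<cdot>\<^sub>m 1\<^sub>m (dim_row B) - const_mat B"

text \<open>Unspecified for a singular matrix, since then \<open>mat_inverse B = None\<close>.\<close>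

definition mat_inv :: "'a :: field mat \<Rightarrow> 'a mat" where
  "mat_inv B = the (mat_inverse B)"

definition isospectral_reduction ::
    "('v \<Rightarrow> 'v \<Rightarrow> complex) \<Rightarrow> 'v list \<Rightarrow> 'v list \<Rightarrow> complex poly fract mat" where
  "isospectral_reduction A ss ts =
     const_mat (block A ss ss) +
     const_mat (block A ss ts) * mat_inv (lam_minus (block A ts ts)) * const_mat (block A ts ss)"

text \<open>The matrix \<open>[I; 0]\<close> with an identity block of size \<open>k\<close> above an \<open>m\<close> by \<open>k\<close> zero block.\<close>

definition Sigma_mat :: "nat \<Rightarrow> nat \<Rightarrow> complex poly fract mat" where
  "Sigma_mat k m = 1\<^sub>m k @\<^sub>r 0\<^sub>m m k"

end

theory Submission
  imports Defs "Jordan_Normal_Form.Char_Poly" "Subresultants.More_Homomorphisms"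
begin

text \<open>
  The determinant of \<open>\<lambda>I - B\<close> is the characteristic polynomial of \<open>B\<close>, which is monic, so \<open>\<lambda>I - A\<close>
  and \<open>\<lambda>I - F\<close> are invertible over the rational functions. Reading the first block column of
  \<open>(\<lambda>I - A) Y = I\<close> shows that the leading block \<open>\<Sigma>\<^sup>T Y \<Sigma>\<close> of the inverse \<open>Y\<close> is inverse to the Schur
  complement \<open>(\<lambda>I - M) - C (\<lambda>I - F)\<inverse> D\<close>.
\<close>

text \<open>Over a field a one-sided inverse of a square matrix is two-sided, so \<open>A\<close> is
  a unit of the matrix ring. This excludes the result \<open>None\<close> of
  \<open>mat_inverse\<close>, and uniqueness of inverses identifies the computed matrix with
  \<open>B\<close>.\<close>

lemma mat_inv_eqI:
  fixes A B :: "'a :: field mat"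
  assumes A: "A \<in> carrier_mat n n" and B: "B \<in> carrier_mat n n" and AB: "A * B = 1\<^sub>m n"
  shows "invertible_mat A" "mat_inv A = B"
proof -
  have BA: "B * A = 1\<^sub>m n"
    by (rule mat_mult_left_right_inverse[OF A B AB])
  show "invertible_mat A"
    using A B AB BA unfolding invertible_mat_def inverts_mat_def by auto
  have "A \<in> Units (ring_mat TYPE('a) n ())"
    using A B AB BA unfolding Units_def ring_mat_def by auto
  then obtain C where C: "mat_inverse A = Some C"
    using mat_inverse(1)[OF A, where b = "()"] by (cases "mat_inverse A") auto
  from mat_inverse(2)[OF A C] have "C * A = 1\<^sub>m n" and Cc: "C \<in> carrier_mat n n"
    by auto
  then have "C = B"
    using assoc_mult_mat[OF Cc A B] AB B by simp
  then show "mat_inv A = B"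
    unfolding mat_inv_def C by simp
qed

lemma det_nonzero_mat_inv:
  fixes A :: "'a :: field mat"
  assumes A: "A \<in> carrier_mat n n" and det: "det A \<noteq> 0"
  shows "invertible_mat A" "mat_inv A \<in> carrier_mat n n"
    "A * mat_inv A = 1\<^sub>m n" "mat_inv A * A = 1\<^sub>m n"
proof -
  obtain B where B: "B \<in> carrier_mat n n" "A * B = 1\<^sub>m n" "B * A = 1\<^sub>m n"
    using det_non_zero_imp_unit[OF A det, of "()"] unfolding Units_def ring_mat_def by auto
  show "invertible_mat A" "mat_inv A \<in> carrier_mat n n"
    "A * mat_inv A = 1\<^sub>m n" "mat_inv A * A = 1\<^sub>m n"
    using mat_inv_eqI[OF A B(1,2)] B by auto
qed

text \<open>Block elimination: the lower equation \<open>C * Y1 + Q * Y3 = 0\<close> gives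
  \<open>Y3 = - R * C * Y1\<close>, and substituting this into the upper equation
  \<open>P * Y1 + B * Y3 = 1\<close> leaves the Schur complement times \<open>Y1\<close>.\<close>

lemma leading_block_inverse:
  fixes P :: "'a :: field mat"
  assumes P: "P \<in> carrier_mat n n" and B: "B \<in> carrier_mat n m"
    and C: "C \<in> carrier_mat m n" and Q: "Q \<in> carrier_mat m m"
    and R: "R \<in> carrier_mat m m" and RQ: "R * Q = 1\<^sub>m m"
    and Y: "Y1 \<in> carrier_mat n n" "Y2 \<in> carrier_mat n m"
      "Y3 \<in> carrier_mat m n" "Y4 \<in> carrier_mat m m"
    and inv: "four_block_mat P B C Q * four_block_mat Y1 Y2 Y3 Y4 = 1\<^sub>m (n + m)"
  shows "(P - B * R * C) * Y1 = 1\<^sub>m n"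
proof -
  have eq: "four_block_mat (P * Y1 + B * Y3) (P * Y2 + B * Y4) (C * Y1 + Q * Y3) (C * Y2 + Q * Y4)
      = four_block_mat (1\<^sub>m n) (0\<^sub>m n m) (0\<^sub>m m n) (1\<^sub>m m)"
    using inv unfolding mult_four_block_mat[OF P B C Q Y] by simp
  have top: "P * Y1 + B * Y3 = 1\<^sub>m n"
  proof (rule eq_matI)
    fix i j assume "i < dim_row (1\<^sub>m n :: 'a mat)" "j < dim_col (1\<^sub>m n :: 'a mat)"
    then show "(P * Y1 + B * Y3) $$ (i, j) = 1\<^sub>m n $$ (i, j)"
      using arg_cong[OF eq, of "\<lambda>X. X $$ (i, j)"] P B C Q Y by simp
  qed (use P B Y in auto)
  \<comment> \<open>The lower left block occupies the rows from \<open>n\<close> on, hence the index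
    \<open>n + i\<close>.\<close>
  have bot: "C * Y1 + Q * Y3 = 0\<^sub>m m n"
  proof (rule eq_matI)
    fix i j assume "i < dim_row (0\<^sub>m m n :: 'a mat)" "j < dim_col (0\<^sub>m m n :: 'a mat)"
    then show "(C * Y1 + Q * Y3) $$ (i, j) = 0\<^sub>m m n $$ (i, j)"
      using arg_cong[OF eq, of "\<lambda>X. X $$ (n + i, j)"] P B C Q Y by simp
  qed (use C Q Y in auto)
  have CY: "C * Y1 \<in> carrier_mat m n" and QY: "Q * Y3 \<in> carrier_mat m n"
    using C Q Y by auto
  have "R * (C * Y1) + R * (Q * Y3) = 0\<^sub>m m n"
    using mult_add_distrib_mat[OF R CY QY] bot R by simp
  moreover have "R * (Q * Y3) = Y3"
    using assoc_mult_mat[OF R Q Y(3)] RQ Y(3) by simp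
  ultimately have sum: "R * (C * Y1) + Y3 = 0\<^sub>m m n"
    by simp
  have RCY: "R * (C * Y1) \<in> carrier_mat m n"
    using R CY by auto
  have "B * (R * (C * Y1)) + B * Y3 = 0\<^sub>m n n"
    using mult_add_distrib_mat[OF B RCY Y(3)] sum B by simp
  moreover have "B * R * C * Y1 = B * (R * (C * Y1))"
    using assoc_mult_mat[of "B * R" n m C n Y1 n] assoc_mult_mat[OF B R CY] B R C Y by auto
  ultimately have zero: "B * R * C * Y1 + B * Y3 = 0\<^sub>m n n"
    by simp
  have "(P - B * R * C) * Y1 = P * Y1 - B * R * C * Y1"
    using minus_mult_distrib_mat[of P n n "B * R * C" Y1 n] P B R C Y by auto
  \<comment> \<open>By \<open>zero\<close>, each entry of \<open>B * Y3\<close> is the negative of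
    that of \<open>B * R * C * Y1\<close>. The name \<open>Z\<close> and the removal of
    \<open>index_mult_mat\<close> keep entries of products from unfolding into scalar
    products.\<close>
  also have "\<dots> = P * Y1 + B * Y3"
  proof (rule eq_matI)
    fix i j assume "i < dim_row (P * Y1 + B * Y3)" "j < dim_col (P * Y1 + B * Y3)"
    then have ij: "i < n" "j < n"
      using B Y by auto
    define Z where "Z = B * R * C * Y1"
    have dims: "Z \<in> carrier_mat n n" "B * Y3 \<in> carrier_mat n n" "P * Y1 \<in> carrier_mat n n"
      unfolding Z_def using P B R C Y by auto
    have "Z $$ (i, j) + (B * Y3) $$ (i, j) = 0"
      using arg_cong[OF zero, of "\<lambda>X. X $$ (i, j)"] ij dims by (simp add: Z_def[symmetric] del: index_mult_mat)
    then show "(P * Y1 - B * R * C * Y1) $$ (i, j) = (P * Y1 + B * Y3) $$ (i, j)"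
      unfolding Z_def[symmetric] using ij dims
      by (simp add: eq_neg_iff_add_eq_0 add.commute minus_unique del: index_mult_mat)
  qed (use P B C R Y in auto)
  finally show ?thesis
    using top by simp
qed

lemma lam_minus_carrier:
  assumes "B \<in> carrier_mat n n"
  shows "lam_minus B \<in> carrier_mat n n"
  using assms unfolding lam_minus_def const_mat_def by auto

text \<open>This presents the matrix as the image of a polynomial matrix under the embedding into
  the fraction field, so that its determinant can be computed over the polynomials.\<close>

lemma lam_minus_eq_char_poly_matrix:
  assumes "B \<in> carrier_mat n n"
  shows "lam_minus B = map_mat to_fract (char_poly_matrix B)"
proof (rule eq_matI)
  fix i j
  assume "i < dim_row (map_mat to_fract (char_poly_matrix B))"
    and "j < dim_col (map_mat to_fract (char_poly_matrix B))"
  then have ij: "i < n" "j < n"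
    using assms by (auto simp: char_poly_matrix_def)
  \<comment> \<open>Entries of \<open>char_poly_matrix B\<close> are \<open>[:- b:]\<close> off the
    diagonal and \<open>[:- b, 1:]\<close> on it; the latter simplifies to
    \<open>pCons (- b) 1\<close>.\<close>
  have neg: "to_fract [:- b:] = - to_fract [:b:]" for b :: complex
    using to_fract_hom.hom_uminus[of "[:b:]"] by simp
  have diag: "to_fract (pCons (- b) 1) = to_fract (pCons 0 1) - to_fract [:b:]" for b :: complex
    using to_fract_hom.hom_minus[of "pCons 0 1" "[:b:]"] by simp
  show "lam_minus B $$ (i, j) = map_mat to_fract (char_poly_matrix B) $$ (i, j)"
    using ij assms
    by (auto simp: lam_minus_def const_mat_def char_poly_matrix_def lam_def
        neg diag simp del: to_fract_hom.hom_uminus)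
qed (use assms in \<open>auto simp: lam_minus_def const_mat_def char_poly_matrix_def\<close>)

text \<open>The embedding \<open>to_fract\<close> is injective and commutes with \<open>det\<close>.
  The case \<open>n = 0\<close>, where the determinant is 1, serves the situation
  \<open>S = V\<close>.\<close>

lemma det_lam_minus_nonzero:
  assumes "B \<in> carrier_mat n n"
  shows "det (lam_minus B) \<noteq> 0"
proof -
  have "char_poly B \<noteq> 0"
    using degree_monic_char_poly[OF assms] by auto
  then show ?thesis
    unfolding lam_minus_eq_char_poly_matrix[OF assms] to_fract_hom.hom_det char_poly_def[symmetric]
    by simp
qed

lemma lam_minus_four_block_mat:
  assumes "M \<in> carrier_mat n n" "C \<in> carrier_mat n m" "D \<in> carrier_mat m n" "F \<in> carrier_mat m m"
  shows "lam_minus (four_block_mat M C D F) =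
    four_block_mat (lam_minus M) (- const_mat C) (- const_mat D) (lam_minus F)"
  by (rule eq_matI) (use assms in \<open>auto simp: lam_minus_def const_mat_def\<close>)

lemma Sigma_mat_compress:
  assumes "Y1 \<in> carrier_mat k k" "Y2 \<in> carrier_mat k m" "Y3 \<in> carrier_mat m k" "Y4 \<in> carrier_mat m m"
  shows "(Sigma_mat k m)\<^sup>T * four_block_mat Y1 Y2 Y3 Y4 * Sigma_mat k m = Y1"
proof -
  \<comment> \<open>A second block column of width 0 turns \<open>Sigma_mat k m\<close> into a
    four-block matrix, so block multiplication applies to both products.\<close>
  have Sig: "Sigma_mat k m = four_block_mat (1\<^sub>m k) (0\<^sub>m k 0) (0\<^sub>m m k) (0\<^sub>m m 0)"
    by (simp add: Sigma_mat_def append_rows_def)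
  have tr: "(Sigma_mat k m)\<^sup>T = four_block_mat (1\<^sub>m k) (0\<^sub>m k m) (0\<^sub>m 0 k) (0\<^sub>m 0 m)"
    unfolding Sig by (subst transpose_four_block_mat[of _ k k _ 0 _ m]) auto
  have left: "(Sigma_mat k m)\<^sup>T * four_block_mat Y1 Y2 Y3 Y4
      = four_block_mat Y1 Y2 (0\<^sub>m 0 k) (0\<^sub>m 0 m)"
    unfolding tr by (subst mult_four_block_mat[of _ k k _ m _ 0]) (use assms in auto)
  show ?thesis
    unfolding left unfolding Sig
    by (subst mult_four_block_mat[of _ k k _ m _ 0 _ _ k _ 0]) (use assms in auto)
qed

theorem theorem2p12:
  fixes V S :: "'v set"
    and A :: "'v \<Rightarrow> 'v \<Rightarrow> complex"
    and ss ts :: "'v list"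
  assumes "finite V" and "S \<subseteq> V" and "S \<noteq> {}"
    and "distinct ss" and "set ss = S"
    and "distinct ts" and "set ts = V - S"
  defines "\<Sigma> \<equiv> Sigma_mat (length ss) (length ts)"
  shows "invertible_mat (lam_minus (block A ts ts)) \<and>
         invertible_mat (lam_minus (block_form A ss ts)) \<and>
         invertible_mat (\<Sigma>\<^sup>T * mat_inv (lam_minus (block_form A ss ts)) * \<Sigma>) \<and>
         isospectral_reduction A ss ts =
           lam \<cdot>\<^sub>m 1\<^sub>m (length ss) -
           mat_inv (\<Sigma>\<^sup>T * mat_inv (lam_minus (block_form A ss ts)) * \<Sigma>)"
proof -
  define n m where "n = length ss" and "m = length ts"
  define M C D F where "M = block A ss ss" and "C = block A ss ts"
    and "D = block A ts ss" and "F = block A ts ts"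
  have carr: "M \<in> carrier_mat n n" "C \<in> carrier_mat n m" "D \<in> carrier_mat m n" "F \<in> carrier_mat m m"
    by (auto simp: M_def C_def D_def F_def block_def n_def m_def)
  have cC: "const_mat C \<in> carrier_mat n m" and cD: "const_mat D \<in> carrier_mat m n"
    using carr by (auto simp: const_mat_def)
  define X where "X = lam_minus (block_form A ss ts)"
  define R where "R = mat_inv (lam_minus F)"
  \<comment> \<open>The Schur complement of \<open>lam_minus F\<close> in \<open>X\<close>. The two
    minus signs come from the off-diagonal blocks of \<open>X\<close> and cancel in
    \<open>CRD\<close>.\<close>
  define K where "K = lam_minus M - (- const_mat C) * R * (- const_mat D)"
  have bf: "block_form A ss ts = four_block_mat M C D F"
    by (simp add: block_form_def M_def C_def D_def F_def)
  have bfc: "four_block_mat M C D F \<in> carrier_mat (n + m) (n + m)"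
    using carr by auto
  have X: "X = four_block_mat (lam_minus M) (- const_mat C) (- const_mat D) (lam_minus F)"
    unfolding X_def bf using carr by (rule lam_minus_four_block_mat)
  have Xc: "X \<in> carrier_mat (n + m) (n + m)"
    unfolding X_def bf using bfc by (rule lam_minus_carrier)
  have Xdet: "det X \<noteq> 0"
    unfolding X_def bf using bfc by (rule det_lam_minus_nonzero)
  note Xinv = det_nonzero_mat_inv[OF Xc Xdet]
  note Finv = det_nonzero_mat_inv[OF lam_minus_carrier[OF carr(4)] det_lam_minus_nonzero[OF carr(4)],
      folded R_def]
  obtain Y1 Y2 Y3 Y4 where "split_block (mat_inv X) n n = (Y1, Y2, Y3, Y4)"
    by (rule prod_cases4)
  from split_block[OF this, of m m] Xinv(2)
  have Y: "Y1 \<in> carrier_mat n n" "Y2 \<in> carrier_mat n m" "Y3 \<in> carrier_mat m n" "Y4 \<in> carrier_mat m m"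
    and XY: "mat_inv X = four_block_mat Y1 Y2 Y3 Y4"
    by auto
  have KY: "K * Y1 = 1\<^sub>m n"
    unfolding K_def
  proof (rule leading_block_inverse[OF _ _ _ _ Finv(2,4) Y])
    show "four_block_mat (lam_minus M) (- const_mat C) (- const_mat D) (lam_minus F)
        * four_block_mat Y1 Y2 Y3 Y4 = 1\<^sub>m (n + m)"
      using Xinv(3)[unfolded XY, unfolded X] .
  qed (use carr cC cD lam_minus_carrier in auto)
  have Kc: "K \<in> carrier_mat n n"
    unfolding K_def using cC cD Finv(2) by auto
  \<comment> \<open>The order is reversed because the matrix to be inverted is \<open>Y1\<close>,
    the compression of \<open>mat_inv X\<close>; its inverse is then \<open>K\<close>.\<close>
  have YK: "Y1 * K = 1\<^sub>m n"
    by (rule mat_mult_left_right_inverse[OF Kc Y(1) KY])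
  have Sig: "\<Sigma>\<^sup>T * mat_inv X * \<Sigma> = Y1"
    unfolding XY \<Sigma>_def n_def[symmetric] m_def[symmetric] by (rule Sigma_mat_compress[OF Y])
  have CRD: "(- const_mat C) * R * (- const_mat D) = const_mat C * R * const_mat D"
    using cC cD Finv(2) by auto
  have CRDc: "const_mat C * R * const_mat D \<in> carrier_mat n n"
    using cC cD Finv(2) by auto
  \<comment> \<open>Since \<open>lam_minus M\<close> is \<lambda>I - M, subtracting \<open>K\<close>
    from \<lambda>I cancels \<lambda> and leaves M + C R D.\<close>
  have "isospectral_reduction A ss ts = lam \<cdot>\<^sub>m 1\<^sub>m n - K"
    unfolding isospectral_reduction_def K_def CRD M_def[symmetric] C_def[symmetric]
      D_def[symmetric] F_def[symmetric] R_def[symmetric]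
    by (rule eq_matI)
      (use carr CRDc in \<open>auto simp: lam_minus_def const_mat_def simp del: index_mult_mat(1)\<close>)
  then show ?thesis
    using Finv(1) Xinv(1) mat_inv_eqI[OF Y(1) Kc YK]
    unfolding X_def[symmetric] F_def[symmetric] n_def[symmetric] Sig by simp
qed

end
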